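(* Let $a,b\in\mathbb{C}$, let $\lambda\in\mathbb{C}$ with $|\lambda|=1$, and let $$P_\lambda(z)=z(z-a)(z-b)-\lambda(1-\overline{a}z)(1-\overline{b}z).$$ Assume that the three roots $z_1,z_2,z_3$ of $P_\lambda(z)$ are distinct and lie on the unit circle. Then each of the three lines connecting two of the roots is tangent to the conic section $$\big||z-a|\pm|z-b|\big|=|1-\overline{a}b|.$$ The line through $z_1$ and $z_2$ is tangent to it at the point $$\zeta_3=\frac{m_1z_2+m_2z_1}{m_1+m_2},$$ and, similarly, the line through $z_2$ and $z_3$ is tangent to it at $\zeta_1=\frac{m_2z_3+m_3z_2}{m_2+m_3}$ and the line through $z_1$ and $z_3$ is tangent to it at $\zeta_2=\frac{m_1z_3+m_3z_1}{m_1+m_3}$. Here $m_1,m_2,m_3$ are real numbers and satisfy $$\frac{(z-a)(z-b)}{(z-z_1)(z-z_2)(z-z_3)}=\frac{m_1}{z-z_1}+\frac{m_2}{z-z_2}+\frac{m_3}{z-z_3}.$$ The conic equation is an ellipse (with the "$+$" sign) if both $a$ and $b$ lie inside the unit circle or they both lie outside the unit circle. If one of $a$ or $b$ lies inside and the other outside the unit circle, then the conic equation (with the "$-$" sign) is a hyperbola.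
   Context: Complex numbers are identified with points of the plane, $\overline{w}$ denotes the complex conjugate of $w$, and the unit circle is $\{z\in\mathbb{C}:|z|=1\}$. The lines are the full lines through pairs of roots, so a point of tangency may lie on the extension of the segment joining the two roots.
   Formalization: If |a|=1 or |b|=1 the conic degenerates to a doubled line and tangency means only double contact with its equation; if the sum of the two m's in a ζ is 0, that ζ is undefined and the line is instead tangent at infinity (an asymptote when |a|,|b|≠1). *)

theory Defs
  imports "HOL-Analysis.Analysis"
begin

definition cubic_P :: "complex \<Rightarrow> complex \<Rightarrow> complex \<Rightarrow> complex \<Rightarrow> complex" where
  "cubic_P a b lam z = z * (z - a) * (z - b) - lam * (1 - cnj a * z) * (1 - cnj b * z)"

text \<open>
  The two sign choices in the equation \<open>||z - a| \<plusminus> |z - b|| = r\<close>.  The equation with an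
  unspecified sign is read as the union of the two loci; unless \<open>r = |a - b|\<close> at most
  one of them is nonempty.
\<close>

definition conic_plus :: "complex \<Rightarrow> complex \<Rightarrow> real \<Rightarrow> complex set" where
  "conic_plus a b r = {z. \<bar>cmod (z - a) + cmod (z - b)\<bar> = r}"

definition conic_minus :: "complex \<Rightarrow> complex \<Rightarrow> real \<Rightarrow> complex set" where
  "conic_minus a b r = {z. \<bar>cmod (z - a) - cmod (z - b)\<bar> = r}"

definition focal_conic :: "complex \<Rightarrow> complex \<Rightarrow> real \<Rightarrow> complex set" where
  "focal_conic a b r = conic_plus a b r \<union> conic_minus a b r"

text \<open>Circles are ellipses with coinciding foci; degenerate loci (segments, rays, lines) are
  excluded by the strict inequalities.\<close>

definition is_ellipse :: "complex set \<Rightarrow> bool" where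
  "is_ellipse S \<longleftrightarrow> (\<exists>f g s. dist f g < s \<and> S = {z. dist z f + dist z g = s})"

definition is_hyperbola :: "complex set \<Rightarrow> bool" where
  "is_hyperbola S \<longleftrightarrow> (\<exists>f g s. 0 < s \<and> s < dist f g \<and> S = {z. \<bar>dist z f - dist z g\<bar> = s})"

text \<open>The line \<open>L\<close> is the tangent line of the point set \<open>C\<close> at its non-isolated point \<open>p\<close>: the
  angle between \<open>L\<close> and the secant from \<open>p\<close> to \<open>z\<close> tends to 0 as \<open>z\<close> tends to \<open>p\<close> in \<open>C\<close>.\<close>

definition tangent_line_at :: "complex set \<Rightarrow> complex set \<Rightarrow> complex \<Rightarrow> bool" where
  "tangent_line_at L C p \<longleftrightarrow> p \<in> L \<and> p \<in> C \<and> p islimpt C \<and>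
     ((\<lambda>z. infdist z L / dist z p) \<longlongrightarrow> 0) (at p within C)"

text \<open>Tangency at the point at infinity of \<open>L\<close>: some branch of \<open>C\<close> runs off to infinity
  approaching \<open>L\<close>.\<close>

definition asymptote_of :: "complex set \<Rightarrow> complex set \<Rightarrow> bool" where
  "asymptote_of L C \<longleftrightarrow> (\<exists>\<gamma> :: real \<Rightarrow> complex.
     continuous_on {0..} \<gamma> \<and> \<gamma> ` {0..} \<subseteq> C \<and> filterlim \<gamma> at_infinity at_top \<and>
     ((\<lambda>t. infdist (\<gamma> t) L) \<longlongrightarrow> 0) at_top)"

text \<open>
  The point-set notions above are meaningless when the conic degenerates to the doubly covered
  line through its foci, which happens when \<open>r = |a - b|\<close>; for \<open>r = |1 - cnj a * b|\<close> this means
  \<open>|a| = 1\<close> or \<open>|b| = 1\<close>, because \<open>r\<^sup>2 - |a - b|\<^sup>2 = (1 - |a|\<^sup>2) (1 - |b|\<^sup>2)\<close>.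
  Tangency to a possibly degenerate conic means double contact with its equation.  With \<open>u = |z - a|\<close> and \<open>v = |z - b|\<close>, the equation
  \<open>conic_eqn\<close> below is the product of the two sign variants; it vanishes (for \<open>r \<ge> 0\<close>) exactly
  on the conic, and since it equals \<open>(r\<^sup>2 + u\<^sup>2 - v\<^sup>2)\<^sup>2 - 4 r\<^sup>2 u\<^sup>2\<close> with \<open>u\<^sup>2 - v\<^sup>2\<close> affine, it is a
  polynomial of degree at most 2 in the coordinates of \<open>z\<close>.
\<close>

definition conic_eqn :: "complex \<Rightarrow> complex \<Rightarrow> real \<Rightarrow> complex \<Rightarrow> real" where
  "conic_eqn a b r z =
     ((cmod (z - a) + cmod (z - b))\<^sup>2 - r\<^sup>2) * ((cmod (z - a) - cmod (z - b))\<^sup>2 - r\<^sup>2)"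

text \<open>For \<open>F\<close> quadratic, the restriction of \<open>F\<close> to the line through \<open>u\<close> and \<open>v\<close> has degree at
  most 2.  It has a double zero at the finite point \<open>p\<close> (or vanishes identically) iff it is
  \<open>c t\<^sup>2\<close> in a parameter centred at \<open>p\<close>, and a double zero at infinity iff it is constant.\<close>

definition double_contact_at :: "(complex \<Rightarrow> real) \<Rightarrow> complex \<Rightarrow> complex \<Rightarrow> complex \<Rightarrow> bool" where
  "double_contact_at F u v p \<longleftrightarrow> p \<in> affine hull {u, v} \<and>
     (\<exists>c. \<forall>t::real. F (p + of_real t * (v - u)) = c * t\<^sup>2)"

definition double_contact_at_infinity :: "(complex \<Rightarrow> real) \<Rightarrow> complex \<Rightarrow> complex \<Rightarrow> bool" where
  "double_contact_at_infinity F u v \<longleftrightarrow> (\<exists>c. \<forall>t::real. F (u + of_real t * (v - u)) = c)"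

end

theory Submission
  imports Defs
begin

text \<open>
  Why the theorem holds.  Write \<open>r = |1 - cnj a * b|\<close> and reflect the focus \<open>a\<close> in the chord
  through two roots \<open>z1, z2\<close>; since the roots have modulus 1, the mirror image is
  \<open>a' = z1 + z2 - z1 * z2 * cnj a\<close>.  The relations between roots and coefficients of
  \<open>P_\<lambda>\<close> give \<open>|a' - b| = r\<close>.  On the chord \<open>|z - a| = |z - a'|\<close>, so the triangle
  \<open>z, a', b\<close> has one side of length \<open>r\<close>, and by Heron's formula the equation of the conic
  restricted to the chord is \<open>-16\<close> times the square of the area of this triangle.  The area is, up
  to sign, an affine function of \<open>z\<close> along the chord, hence the restricted equation has a double
  zero where the line through \<open>a'\<close> and \<open>b\<close> meets the chord, or is constant if these two lines are
  parallel.  At the ends of the chord the signed areas are proportional to \<open>m1\<close> and \<open>-m2\<close>.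
  Interpolating linearly, the zero is \<open>(m1 * z2 + m2 * z1) / (m1 + m2)\<close>, and the lines are parallel
  exactly if \<open>m1 + m2 = 0\<close>.

  To pass from the equation to the point set, note
  \<open>r\<^sup>2 - |a - b|\<^sup>2 = (1 - |a|\<^sup>2) * (1 - |b|\<^sup>2)\<close>.  If neither focus is on the unit circle, then
  \<open>r \<noteq> |a - b|\<close>, and the equation has a nonzero gradient at each of its zeros.  Therefore a double
  zero on a line is genuine tangency; and when the equation is a nonzero constant on a line, solving
  it for the coordinate along the line yields a branch asymptotic to the line.  The sign of
  \<open>r - |a - b|\<close> also separates ellipses from hyperbolas.
\<close>


section \<open>The equation of a conic with given foci\<close>

lemma conic_eqn_eq:
  "conic_eqn a b r z =
     (r\<^sup>2 + (cmod (z - a))\<^sup>2 - (cmod (z - b))\<^sup>2)\<^sup>2 - 4 * r\<^sup>2 * (cmod (z - a))\<^sup>2"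
  unfolding conic_eqn_def by algebra

lemma conic_eqn_zero_iff:
  assumes "r \<ge> 0"
  shows "conic_eqn a b r z = 0 \<longleftrightarrow> z \<in> focal_conic a b r"
proof -
  have "x\<^sup>2 - r\<^sup>2 = 0 \<longleftrightarrow> \<bar>x\<bar> = r" for x :: real
    using assms by (metis abs_of_nonneg eq_iff_diff_eq_0 power2_abs power2_eq_iff_nonneg abs_ge_zero)
  then show ?thesis
    unfolding conic_eqn_def focal_conic_def conic_plus_def conic_minus_def by simp
qed

text \<open>
  By Heron's formula the left-hand side is \<open>-16\<close> times the squared area of the triangle with
  side lengths \<open>|z - a|\<close>, \<open>|z - b|\<close> and \<open>r\<close>.  The triangle \<open>z, a', b\<close> has these side lengths.
\<close>
lemma conic_eqn_eq_area:
  assumes "cmod (z - a') = cmod (z - a)" "cmod (a' - b) = r"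
  shows "conic_eqn a b r z = - 4 * (Im ((z - a') * cnj (a' - b)))\<^sup>2"
  unfolding conic_eqn_eq assms(1)[symmetric] assms(2)[symmetric]
  unfolding cmod_power2 by (simp add: power2_eq_square) algebra

definition conic_gradient :: "complex \<Rightarrow> complex \<Rightarrow> real \<Rightarrow> complex \<Rightarrow> complex" where
  "conic_gradient a b r z = 4 * (of_real (r\<^sup>2 + (cmod (z - a))\<^sup>2 - (cmod (z - b))\<^sup>2) * (b - a)
     - 2 * of_real (r\<^sup>2) * (z - a))"

definition conic_quadratic_form :: "complex \<Rightarrow> complex \<Rightarrow> real \<Rightarrow> complex \<Rightarrow> real" where
  "conic_quadratic_form a b r h = 4 * ((b - a) \<bullet> h)\<^sup>2 - 4 * r\<^sup>2 * (cmod h)\<^sup>2"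

lemma conic_eqn_expand:
  "conic_eqn a b r (z + h) =
     conic_eqn a b r z + conic_gradient a b r z \<bullet> h + conic_quadratic_form a b r h"
proof -
  define u where "u = (cmod (z - a))\<^sup>2"
  define v where "v = (cmod (z - b))\<^sup>2"
  define x where "x = (z - a) \<bullet> h"
  define y where "y = (b - a) \<bullet> h"
  have *: "(cmod (z + h - c))\<^sup>2 = (cmod (z - c))\<^sup>2 + 2 * ((z - c) \<bullet> h) + (cmod h)\<^sup>2" for c
    using dot_norm[of "z - c" h] by (simp add: algebra_simps)
  have zb: "(z - b) \<bullet> h = x - y"
    unfolding x_def y_def by (simp add: inner_diff_left)
  have "conic_gradient a b r z \<bullet> h = 4 * ((r\<^sup>2 + u - v) * y - 2 * r\<^sup>2 * x)"
    unfolding conic_gradient_def u_def[symmetric] v_def[symmetric] x_def y_def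
    by (simp add: inner_complex_def algebra_simps)
  then show ?thesis
    unfolding conic_eqn_eq conic_quadratic_form_def * zb
      u_def[symmetric] v_def[symmetric] x_def[symmetric] y_def[symmetric]
    by (simp add: power2_eq_square algebra_simps)
qed

lemma conic_quadratic_form_bound:
  "\<bar>conic_quadratic_form a b r h\<bar> \<le> 4 * ((cmod (b - a))\<^sup>2 + r\<^sup>2) * (cmod h)\<^sup>2"
proof -
  have "((b - a) \<bullet> h)\<^sup>2 \<le> (cmod (b - a))\<^sup>2 * (cmod h)\<^sup>2"
    using Cauchy_Schwarz_ineq[of "b - a" h] by (simp add: power2_norm_eq_inner)
  moreover have "0 \<le> ((b - a) \<bullet> h)\<^sup>2" "0 \<le> r\<^sup>2 * (cmod h)\<^sup>2"
    by simp_all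
  moreover have "0 \<le> (cmod (b - a))\<^sup>2 * (cmod h)\<^sup>2" by simp
  ultimately show ?thesis
    unfolding conic_quadratic_form_def abs_le_iff distrib_left distrib_right by linarith
qed

text \<open>
  If the gradient vanishes at a zero, put \<open>k = r\<^sup>2 + |z - a|\<^sup>2 - |z - b|\<^sup>2\<close>: the equation says
  \<open>k\<^sup>2 = 4 * r\<^sup>2 * |z - a|\<^sup>2\<close> and the gradient says \<open>k * (b - a) = 2 * r\<^sup>2 * (z - a)\<close>.  Comparing the
  moduli, either \<open>|b - a| = r\<close>, or \<open>k = 0\<close>; the latter forces \<open>z = a\<close>, and then
  \<open>k = r\<^sup>2 - |b - a|\<^sup>2\<close>.
\<close>
lemma conic_gradient_nonzero:
  assumes "r > 0" "r \<noteq> cmod (a - b)" "conic_eqn a b r z = 0"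
  shows "conic_gradient a b r z \<noteq> 0"
proof
  define k where "k = r\<^sup>2 + (cmod (z - a))\<^sup>2 - (cmod (z - b))\<^sup>2"
  assume "conic_gradient a b r z = 0"
  then have *: "of_real k * (b - a) = of_real (2 * r\<^sup>2) * (z - a)"
    unfolding conic_gradient_def k_def of_real_mult of_real_numeral by (simp only: mult_eq_0_iff) simp
  have k2: "k\<^sup>2 = 4 * r\<^sup>2 * (cmod (z - a))\<^sup>2"
    using assms(3) unfolding conic_eqn_eq k_def by simp
  have "(cmod (of_real k * (b - a)))\<^sup>2 = (cmod (of_real (2 * r\<^sup>2) * (z - a)))\<^sup>2"
    using * by simp
  then have "k\<^sup>2 * (cmod (b - a))\<^sup>2 = (2 * r\<^sup>2)\<^sup>2 * (cmod (z - a))\<^sup>2"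
    unfolding norm_mult norm_of_real power_mult_distrib power2_abs .
  also have "\<dots> = r\<^sup>2 * k\<^sup>2"
    unfolding k2 by algebra
  finally have eq: "k\<^sup>2 * ((cmod (b - a))\<^sup>2 - r\<^sup>2) = 0"
    by algebra
  have ne: "(cmod (b - a))\<^sup>2 \<noteq> r\<^sup>2"
    using assms(1,2) by (metis norm_ge_zero norm_minus_commute order_less_imp_le power2_eq_iff_nonneg)
  with eq have "k = 0" by simp
  with k2 assms(1) have "z = a" by simp
  with \<open>k = 0\<close> ne show False
    unfolding k_def by (simp add: norm_minus_commute)
qed


section \<open>From double contact to tangent lines and asymptotes\<close>

text \<open>
  The equation takes both signs on every small circle around a zero with nonzero gradient, and a
  circle in the plane is connected.
\<close>
lemma focal_conic_islimpt:
  assumes "r \<ge> 0" "conic_eqn a b r p = 0" and G: "conic_gradient a b r p \<noteq> 0"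
  shows "p islimpt focal_conic a b r"
  unfolding islimpt_approachable
proof (intro allI impI)
  fix e :: real assume "e > 0"
  define G where "G = conic_gradient a b r p"
  define M where "M = 4 * ((cmod (b - a))\<^sup>2 + r\<^sup>2)"
  have Gpos: "cmod G > 0" using G unfolding G_def by simp
  have M0: "M \<ge> 0" unfolding M_def by simp
  \<comment> \<open>On the circle of radius \<open>\<rho>\<close> the gradient term reaches \<open>\<rho> * |G|\<close> in both signs, which
      exceeds the bound \<open>M * \<rho>\<^sup>2\<close> for the quadratic term.\<close>
  define \<rho> where "\<rho> = min (e / 2) (cmod G / (M + 1) / 2)"
  have \<rho>: "\<rho> > 0" "\<rho> < e"
    using \<open>e > 0\<close> Gpos M0 unfolding \<rho>_def by (simp_all add: min_less_iff_disj)
  have "\<rho> * (M + 1) \<le> cmod G / (M + 1) / 2 * (M + 1)"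
    using M0 by (intro mult_right_mono) (auto simp: \<rho>_def)
  also have "\<dots> < cmod G" using M0 Gpos by (simp add: field_simps add_pos_nonneg)
  finally have small: "\<rho> * M < cmod G" using \<rho> by (simp add: algebra_simps)
  define h where "h = of_real (\<rho> / cmod G) * G"
  have nh: "cmod h = \<rho>" unfolding h_def norm_mult norm_of_real using \<rho> Gpos by simp
  have Gh: "G \<bullet> h = \<rho> * cmod G"
  proof -
    have "G \<bullet> h = \<rho> / cmod G * (G \<bullet> G)"
      unfolding h_def by (simp add: inner_complex_def algebra_simps)
    also have "\<dots> = \<rho> * cmod G"
      using Gpos by (simp add: dot_square_norm power2_eq_square)
    finally show ?thesis .
  qed
  have q: "\<bar>conic_quadratic_form a b r x\<bar> \<le> M * \<rho>\<^sup>2" if "cmod x = \<rho>" for x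
    using conic_quadratic_form_bound[of a b r x] that unfolding M_def by simp
  have qs: "M * \<rho>\<^sup>2 < \<rho> * cmod G"
    using mult_strict_left_mono[OF small \<rho>(1)] by (simp add: power2_eq_square algebra_simps)
  have pos: "conic_eqn a b r (p + h) \<ge> 0"
    using conic_eqn_expand[of a b r p h] q[of h] nh Gh qs assms(2) unfolding G_def by simp
  have neg: "conic_eqn a b r (p + - h) \<le> 0"
    using conic_eqn_expand[of a b r p "-h"] q[of "-h"] nh Gh qs assms(2) unfolding G_def by simp
  have "continuous_on (sphere p \<rho>) (conic_eqn a b r)"
    unfolding conic_eqn_def by (intro continuous_intros)
  moreover have "connected (sphere p \<rho>)"
    by (rule connected_sphere) simp
  ultimately have "connected (conic_eqn a b r ` sphere p \<rho>)"
    by (rule connected_continuous_image)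
  moreover have "p + h \<in> sphere p \<rho>" "p + - h \<in> sphere p \<rho>"
    using nh by (simp_all add: dist_norm)
  ultimately have "0 \<in> conic_eqn a b r ` sphere p \<rho>"
    using pos neg unfolding connected_iff_interval by blast
  then obtain z where z: "z \<in> sphere p \<rho>" "conic_eqn a b r z = 0" by auto
  have "z \<in> focal_conic a b r" using z(2) conic_eqn_zero_iff[OF assms(1)] by simp
  moreover have "dist z p = \<rho>" using z(1) by (simp add: dist_commute)
  ultimately show "\<exists>x'\<in>focal_conic a b r. x' \<noteq> p \<and> dist x' p < e"
    using \<rho> by (intro bexI[of _ z]) auto
qed

lemma on_line_through:
  "u + of_real t * (v - u) \<in> affine hull {u, v :: complex}"
  unfolding affine_hull_2
  by (rule CollectI, rule exI[of _ "1 - t"], rule exI[of _ t])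
     (simp add: scaleR_conv_of_real algebra_simps)

lemma line_through_translate:
  assumes "p \<in> affine hull {u, v :: complex}"
  shows "p + of_real t * (v - u) \<in> affine hull {u, v}"
proof -
  obtain x y where "x + y = 1" and p: "p = x *\<^sub>R u + y *\<^sub>R v"
    using assms unfolding affine_hull_2 by auto
  then have "x = 1 - y" by simp
  with p have "p + of_real t * (v - u) = u + of_real (y + t) * (v - u)"
    by (simp add: scaleR_conv_of_real algebra_simps)
  then show ?thesis using on_line_through by metis
qed

lemma complex_rotated_components:
  fixes e h :: complex
  assumes "e \<noteq> 0"
  shows "h = of_real (e \<bullet> h / (cmod e)\<^sup>2) * e + of_real ((\<i> * e) \<bullet> h / (cmod e)\<^sup>2) * (\<i> * e)"
proof -
  have "of_real ((cmod e)\<^sup>2) * h = of_real (e \<bullet> h) * e + of_real ((\<i> * e) \<bullet> h) * (\<i> * e)"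
    unfolding cmod_power2 inner_complex_def complex_eq_iff
    by (simp add: power2_eq_square algebra_simps)
  moreover have "complex_of_real ((cmod e)\<^sup>2) \<noteq> 0" using assms by simp
  ultimately show ?thesis
    unfolding of_real_divide times_divide_eq_left add_divide_distrib[symmetric]
    by (metis nonzero_mult_div_cancel_left)
qed

text \<open>
  The gradient is orthogonal to the line, so the distance of \<open>p + h\<close> from the line is
  proportional to the gradient term of the equation.  On the conic this term equals the quadratic
  term up to sign, and is therefore of second order in \<open>h\<close>.
\<close>
lemma double_contact_imp_tangent:
  assumes r: "r > 0" "r \<noteq> cmod (a - b)" and uv: "u \<noteq> v"
    and dc: "double_contact_at (conic_eqn a b r) u v p"
  shows "tangent_line_at (affine hull {u, v}) (focal_conic a b r) p"
proof -
  define e where "e = v - u"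
  define F where "F = conic_eqn a b r"
  define G where "G = conic_gradient a b r p"
  have e0: "e \<noteq> 0" using uv unfolding e_def by simp
  obtain c where pL: "p \<in> affine hull {u, v}" and c: "\<And>t. F (p + of_real t * e) = c * t\<^sup>2"
    using dc unfolding double_contact_at_def e_def F_def by blast
  have Fp: "F p = 0" using c[of 0] by simp
  have G0: "G \<noteq> 0" using conic_gradient_nonzero[OF r] Fp unfolding F_def G_def by simp
  have ortho: "G \<bullet> e = 0"
  proof -
    have "F (p + e) = F (p + - e)" using c[of 1] c[of "-1"] by simp
    moreover have "conic_quadratic_form a b r (- e) = conic_quadratic_form a b r e"
      unfolding conic_quadratic_form_def by simp
    ultimately show ?thesis
      using conic_eqn_expand[of a b r p e] conic_eqn_expand[of a b r p "- e"]
      unfolding F_def G_def by simp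
  qed
  define N where "N = G \<bullet> (\<i> * e)"
  have N0: "N \<noteq> 0"
  proof
    assume "N = 0"
    then have "G = 0"
      using complex_rotated_components[OF e0, of G] ortho unfolding N_def
      by (simp add: inner_commute)
    with G0 show False by simp
  qed
  define M where "M = 4 * ((cmod (b - a))\<^sup>2 + r\<^sup>2)"
  define K where "K = M * cmod e / \<bar>N\<bar>"
  have bound: "infdist z (affine hull {u, v}) \<le> K * (dist z p)\<^sup>2" if z: "z \<in> focal_conic a b r" for z
  proof -
    define h where "h = z - p"
    define t where "t = e \<bullet> h / (cmod e)\<^sup>2"
    define s where "s = (\<i> * e) \<bullet> h / (cmod e)\<^sup>2"
    have h: "h = of_real t * e + of_real s * (\<i> * e)"
      using complex_rotated_components[OF e0, of h] unfolding t_def s_def .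
    have "G \<bullet> h = t * (G \<bullet> e) + s * N"
      unfolding N_def by (subst h) (simp add: inner_complex_def algebra_simps)
    then have Gh: "G \<bullet> h = s * N" using ortho by simp
    have "conic_eqn a b r (p + h) = 0"
      using z conic_eqn_zero_iff[of r] r(1) unfolding h_def by simp
    then have "\<bar>G \<bullet> h\<bar> = \<bar>conic_quadratic_form a b r h\<bar>"
      using conic_eqn_expand[of a b r p h] Fp unfolding F_def G_def by simp
    then have "\<bar>s\<bar> * \<bar>N\<bar> \<le> M * (cmod h)\<^sup>2"
      using conic_quadratic_form_bound[of a b r h] unfolding Gh M_def by (simp add: abs_mult)
    then have "\<bar>s\<bar> \<le> M * (cmod h)\<^sup>2 / \<bar>N\<bar>"
      using N0 by (simp add: field_simps)
    then have "\<bar>s\<bar> * cmod e \<le> M * (cmod h)\<^sup>2 / \<bar>N\<bar> * cmod e"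
      by (rule mult_right_mono) simp
    then have s: "\<bar>s\<bar> * cmod e \<le> K * (cmod h)\<^sup>2"
      unfolding K_def by (simp add: algebra_simps)
    have "infdist z (affine hull {u, v}) \<le> dist z (p + of_real t * e)"
      unfolding e_def by (rule infdist_le[OF line_through_translate[OF pL]])
    also have "z - (p + of_real t * e) = of_real s * (\<i> * e)"
      using h unfolding h_def by (simp add: algebra_simps)
    then have "dist z (p + of_real t * e) = \<bar>s\<bar> * cmod e"
      unfolding dist_norm by (simp add: norm_mult)
    finally show ?thesis using s unfolding h_def dist_norm by simp
  qed
  have "((\<lambda>z. infdist z (affine hull {u, v}) / dist z p) \<longlongrightarrow> 0) (at p within focal_conic a b r)"
  proof (rule tendsto_sandwich[of "\<lambda>_. 0" _ _ "\<lambda>z. K * dist z p"])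
    show "\<forall>\<^sub>F z in at p within focal_conic a b r. 0 \<le> infdist z (affine hull {u, v}) / dist z p"
      by (simp add: infdist_nonneg)
    show "\<forall>\<^sub>F z in at p within focal_conic a b r.
        infdist z (affine hull {u, v}) / dist z p \<le> K * dist z p"
      unfolding eventually_at_filter
    proof (intro always_eventually allI impI)
      fix z assume "z \<noteq> p" "z \<in> focal_conic a b r"
      then show "infdist z (affine hull {u, v}) / dist z p \<le> K * dist z p"
        using bound[of z] by (simp add: divide_le_eq power2_eq_square algebra_simps)
    qed
    have "((\<lambda>z. K * dist z p) \<longlongrightarrow> K * dist p p) (at p within focal_conic a b r)"
      by (intro tendsto_intros)
    then show "((\<lambda>z. K * dist z p) \<longlongrightarrow> 0) (at p within focal_conic a b r)" by simp
  qed simp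
  moreover have "p islimpt focal_conic a b r"
    using focal_conic_islimpt[of r a b p] Fp G0 r(1) unfolding F_def G_def by simp
  moreover have "p \<in> focal_conic a b r"
    using conic_eqn_zero_iff[of r] Fp r(1) unfolding F_def by simp
  ultimately show ?thesis unfolding tangent_line_at_def using pL by simp
qed

text \<open>
  In coordinates \<open>t, s\<close> along and across the line, the equation is
  \<open>c + \<alpha> * s + \<beta> * t * s + \<delta> * s\<^sup>2 = 0\<close>, because it is the constant \<open>c\<close> for \<open>s = 0\<close>.
  If \<open>\<beta>\<close> and \<open>c\<close> are nonzero, it can be solved for \<open>t\<close>, and \<open>t\<close> tends to infinity as \<open>s\<close> tends
  to 0.  Nondegeneracy of the conic gives \<open>\<beta> \<noteq> 0\<close>.
\<close>
lemma double_contact_at_infinity_imp_asymptote: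
  assumes r: "r > 0" "r \<noteq> cmod (a - b)" and uv: "u \<noteq> v"
    and dc: "double_contact_at_infinity (conic_eqn a b r) u v"
    and nz: "conic_eqn a b r u \<noteq> 0"
  shows "asymptote_of (affine hull {u, v}) (focal_conic a b r)"
proof -
  define e where "e = v - u"
  define c where "c = conic_eqn a b r u"
  define G where "G = conic_gradient a b r u"
  define Q where "Q = conic_quadratic_form a b r"
  have e0: "e \<noteq> 0" using uv unfolding e_def by simp
  obtain c' where c': "\<And>t. conic_eqn a b r (u + of_real t * e) = c'"
    using dc unfolding double_contact_at_infinity_def e_def by blast
  have c'c: "c' = c" using c'[of 0] unfolding c_def by simp
  have Qm: "Q (- e) = Q e" unfolding Q_def conic_quadratic_form_def by simp
  have 1: "G \<bullet> e + Q e = 0"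
    using conic_eqn_expand[of a b r u e] c'[of 1] c'c unfolding G_def Q_def c_def by simp
  have 2: "- (G \<bullet> e) + Q e = 0"
    using conic_eqn_expand[of a b r u "- e"] c'[of "-1"] c'c Qm unfolding G_def Q_def c_def by simp
  have Ge: "G \<bullet> e = 0" and Qe: "Q e = 0" using 1 2 by simp_all
  define \<alpha> where "\<alpha> = G \<bullet> (\<i> * e)"
  define \<beta> where "\<beta> = 8 * ((b - a) \<bullet> e) * ((b - a) \<bullet> (\<i> * e))"
  define \<delta> where "\<delta> = Q (\<i> * e)"
  have F: "conic_eqn a b r (u + (of_real t * e + of_real s * (\<i> * e)))
      = c + \<alpha> * s + \<beta> * t * s + \<delta> * s\<^sup>2" for t s
  proof -
    have "G \<bullet> (of_real t * e + of_real s * (\<i> * e)) = t * (G \<bullet> e) + s * \<alpha>"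
      unfolding \<alpha>_def by (simp add: inner_complex_def algebra_simps)
    moreover have "Q (of_real t * e + of_real s * (\<i> * e)) = t\<^sup>2 * Q e + \<beta> * t * s + s\<^sup>2 * \<delta>"
      unfolding \<beta>_def \<delta>_def Q_def conic_quadratic_form_def cmod_power2 inner_complex_def
      by (simp add: power2_eq_square algebra_simps)
    ultimately show ?thesis
      using conic_eqn_expand[of a b r u "of_real t * e + of_real s * (\<i> * e)"] Ge Qe
      unfolding G_def[symmetric] Q_def[symmetric] c_def[symmetric] by simp
  qed
  have \<beta>: "\<beta> \<noteq> 0"
  proof -
    have de: "((b - a) \<bullet> e)\<^sup>2 = r\<^sup>2 * (cmod e)\<^sup>2"
      using Qe unfolding Q_def conic_quadratic_form_def by simp
    then have "(b - a) \<bullet> e \<noteq> 0" using r(1) e0 by auto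
    moreover have "(b - a) \<bullet> (\<i> * e) \<noteq> 0"
    proof
      assume 0: "(b - a) \<bullet> (\<i> * e) = 0"
      have "((b - a) \<bullet> e)\<^sup>2 + ((b - a) \<bullet> (\<i> * e))\<^sup>2 = (cmod (b - a))\<^sup>2 * (cmod e)\<^sup>2"
        unfolding cmod_power2 inner_complex_def by (simp add: power2_eq_square algebra_simps)
      then have "r\<^sup>2 * (cmod e)\<^sup>2 = (cmod (b - a))\<^sup>2 * (cmod e)\<^sup>2" using 0 de by simp
      then have "r\<^sup>2 = (cmod (b - a))\<^sup>2" using e0 by simp
      then have "r = cmod (b - a)" using r(1) by simp
      then show False using r(2) by (simp add: norm_minus_commute)
    qed
    ultimately show ?thesis unfolding \<beta>_def by simp
  qed
  have c0: "c \<noteq> 0" using nz unfolding c_def .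
  define s :: "real \<Rightarrow> real" where "s \<tau> = 1 / (\<tau> + 1)" for \<tau>
  define t :: "real \<Rightarrow> real" where "t \<tau> = - (c * (\<tau> + 1) + \<alpha> + \<delta> * s \<tau>) / \<beta>" for \<tau>
  define \<gamma> where "\<gamma> \<tau> = u + (of_real (t \<tau>) * e + of_real (s \<tau>) * (\<i> * e))" for \<tau>
  have "continuous_on {0..} \<gamma>"
    unfolding \<gamma>_def t_def s_def by (intro continuous_intros) (use \<beta> in auto)
  moreover have "\<gamma> ` {0..} \<subseteq> focal_conic a b r"
  proof
    fix z assume "z \<in> \<gamma> ` {0..}"
    then obtain \<tau> where \<tau>: "\<tau> \<ge> 0" "z = \<gamma> \<tau>" by auto
    have bt: "\<beta> * t \<tau> = - (c * (\<tau> + 1) + \<alpha> + \<delta> * s \<tau>)"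
      unfolding t_def using \<beta> by simp
    have s1: "(\<tau> + 1) * s \<tau> = 1" unfolding s_def using \<tau>(1) by simp
    have "c + \<alpha> * s \<tau> + \<beta> * t \<tau> * s \<tau> + \<delta> * (s \<tau>)\<^sup>2 = c - c * ((\<tau> + 1) * s \<tau>)"
      unfolding bt by (simp add: power2_eq_square algebra_simps)
    then have "conic_eqn a b r z = 0" unfolding \<tau>(2) \<gamma>_def F s1 by simp
    then show "z \<in> focal_conic a b r" using conic_eqn_zero_iff[of r] r(1) by simp
  qed
  moreover have s0: "(s \<longlongrightarrow> 0) at_top"
  proof -
    have "filterlim (\<lambda>\<tau>::real. 1 + \<tau>) at_top at_top"
      by (rule filterlim_tendsto_add_at_top[OF tendsto_const filterlim_ident])
    then have "filterlim (\<lambda>\<tau>::real. \<tau> + 1) at_top at_top" by (simp only: add.commute)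
    then show ?thesis
      unfolding s_def by (intro tendsto_divide_0[OF tendsto_const] filterlim_at_top_imp_at_infinity)
  qed
  moreover have "filterlim \<gamma> at_infinity at_top"
  proof -
    \<comment> \<open>\<open>\<gamma>\<close> is a linear term with nonzero velocity plus a convergent term.\<close>
    define w where "w = of_real (- c / \<beta>) * e"
    define g where "g \<tau> = u + (of_real (- (c + \<alpha> + \<delta> * s \<tau>) / \<beta>) * e + of_real (s \<tau>) * (\<i> * e))" for \<tau>
    have w0: "w \<noteq> 0" unfolding w_def using c0 \<beta> e0 by simp
    have \<gamma>: "\<gamma> = (\<lambda>\<tau>. g \<tau> + of_real \<tau> * w)"
      by (rule ext)
         (simp add: \<gamma>_def g_def w_def t_def add_divide_distrib diff_divide_distrib algebra_simps)
    have "(g \<longlongrightarrow> u + (of_real (- (c + \<alpha> + \<delta> * 0) / \<beta>) * e + of_real 0 * (\<i> * e))) at_top"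
      unfolding g_def by (intro tendsto_intros s0) (use \<beta> in auto)
    moreover have "filterlim (\<lambda>\<tau>. of_real \<tau> * w) at_infinity at_top"
      by (rule tendsto_mult_filterlim_at_infinity[OF tendsto_const w0, unfolded mult.commute[of w]])
         (rule filterlim_of_real_at_infinity)
    ultimately show ?thesis
      unfolding \<gamma> by (rule tendsto_add_filterlim_at_infinity)
  qed
  moreover have "((\<lambda>\<tau>. infdist (\<gamma> \<tau>) (affine hull {u, v})) \<longlongrightarrow> 0) at_top"
  proof (rule tendsto_sandwich[of "\<lambda>_. 0" _ _ "\<lambda>\<tau>. \<bar>s \<tau>\<bar> * cmod e"])
    have "infdist (\<gamma> \<tau>) (affine hull {u, v}) \<le> \<bar>s \<tau>\<bar> * cmod e" for \<tau>
    proof -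
      have "infdist (\<gamma> \<tau>) (affine hull {u, v}) \<le> dist (\<gamma> \<tau>) (u + of_real (t \<tau>) * e)"
        unfolding e_def by (rule infdist_le[OF on_line_through])
      also have "\<dots> = \<bar>s \<tau>\<bar> * cmod e"
        unfolding \<gamma>_def dist_norm by (simp add: norm_mult)
      finally show ?thesis .
    qed
    then show "\<forall>\<^sub>F \<tau> in at_top. infdist (\<gamma> \<tau>) (affine hull {u, v}) \<le> \<bar>s \<tau>\<bar> * cmod e" by simp
    have "((\<lambda>\<tau>. \<bar>s \<tau>\<bar> * cmod e) \<longlongrightarrow> \<bar>0\<bar> * cmod e) at_top" by (intro tendsto_intros s0)
    then show "((\<lambda>\<tau>. \<bar>s \<tau>\<bar> * cmod e) \<longlongrightarrow> 0) at_top" by simp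
  qed (simp_all add: infdist_nonneg)
  ultimately show ?thesis unfolding asymptote_of_def by blast
qed


section \<open>Ellipse or hyperbola\<close>

lemma focal_conic_ellipse:
  assumes "cmod (a - b) < r"
  shows "focal_conic a b r = conic_plus a b r" "is_ellipse (conic_plus a b r)"
proof -
  have "\<bar>cmod (z - a) - cmod (z - b)\<bar> \<le> cmod (a - b)" for z
    using norm_triangle_ineq3[of "z - a" "z - b"] by (simp add: norm_minus_commute)
  then have "conic_minus a b r = {}"
    using assms unfolding conic_minus_def by (auto simp: not_le[symmetric])
  then show "focal_conic a b r = conic_plus a b r" unfolding focal_conic_def by simp
  show "is_ellipse (conic_plus a b r)"
    unfolding is_ellipse_def conic_plus_def using assms
    by (intro exI[of _ a] exI[of _ b] exI[of _ r]) (simp add: dist_norm)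
qed

lemma focal_conic_hyperbola:
  assumes "0 < r" "r < cmod (a - b)"
  shows "focal_conic a b r = conic_minus a b r" "is_hyperbola (conic_minus a b r)"
proof -
  have "cmod (a - b) \<le> \<bar>cmod (z - a) + cmod (z - b)\<bar>" for z
    using norm_triangle_ineq4[of "z - b" "z - a"] by simp
  then have "conic_plus a b r = {}"
    using assms unfolding conic_plus_def by (auto simp: not_le[symmetric])
  then show "focal_conic a b r = conic_minus a b r" unfolding focal_conic_def by simp
  show "is_hyperbola (conic_minus a b r)"
    unfolding is_hyperbola_def conic_minus_def using assms
    by (intro exI[of _ a] exI[of _ b] exI[of _ r]) (simp add: dist_norm)
qed

lemma cmod_one_minus_cnj_mult_power2:
  "(cmod (1 - cnj a * b))\<^sup>2 - (cmod (a - b))\<^sup>2 = (1 - (cmod a)\<^sup>2) * (1 - (cmod b)\<^sup>2)"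
  unfolding cmod_power2 by (simp add: power2_eq_square algebra_simps)


section \<open>Polynomials of degree at most three\<close>

lemma monic_cubic_vieta:
  fixes x y z :: "'a :: idom"
  assumes "x \<noteq> y" "y \<noteq> z" "x \<noteq> z"
    and "\<And>t. t \<in> {x, y, z} \<Longrightarrow> t ^ 3 - c2 * t ^ 2 + c1 * t - c0 = 0"
  shows "x + y + z = c2" "x * y + y * z + x * z = c1" "x * y * z = c0"
proof -
  have ex: "x ^ 3 - c2 * x ^ 2 + c1 * x - c0 = 0" and ey: "y ^ 3 - c2 * y ^ 2 + c1 * y - c0 = 0"
    and ez: "z ^ 3 - c2 * z ^ 2 + c1 * z - c0 = 0"
    using assms(4) by auto
  have "(x - y) * (x ^ 2 + x * y + y ^ 2 - c2 * (x + y) + c1) = 0" using ex ey by algebra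
  then have xy: "x ^ 2 + x * y + y ^ 2 - c2 * (x + y) + c1 = 0" using assms(1) by simp
  have "(y - z) * (y ^ 2 + y * z + z ^ 2 - c2 * (y + z) + c1) = 0" using ey ez by algebra
  then have yz: "y ^ 2 + y * z + z ^ 2 - c2 * (y + z) + c1 = 0" using assms(2) by simp
  have "(x - z) * (x + y + z - c2) = 0" using xy yz by algebra
  then show s: "x + y + z = c2" using assms(3) by simp
  show p: "x * y + y * z + x * z = c1" using xy s by algebra
  show "x * y * z = c0" using ex s p by algebra
qed

lemma partial_fractions_three_poles:
  fixes x y z t c0 c1 :: "'a :: field"
  assumes "x \<noteq> y" "y \<noteq> z" "x \<noteq> z" "t \<noteq> x" "t \<noteq> y" "t \<noteq> z"
    and "p * ((x - y) * (x - z)) = (x - c0) * (x - c1)"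
    and "q * ((y - x) * (y - z)) = (y - c0) * (y - c1)"
    and "s * ((z - x) * (z - y)) = (z - c0) * (z - c1)"
  shows "(t - c0) * (t - c1) / ((t - x) * (t - y) * (t - z)) = p / (t - x) + q / (t - y) + s / (t - z)"
proof -
  have "(t - c0) * (t - c1) * ((x - y) * (y - z) * (x - z))
     = (p * (t - y) * (t - z) + q * (t - x) * (t - z) + s * (t - x) * (t - y)) * ((x - y) * (y - z) * (x - z))"
    using assms(7-9) by algebra
  then have "(t - c0) * (t - c1) = p * (t - y) * (t - z) + q * (t - x) * (t - z) + s * (t - x) * (t - y)"
    using assms(1-3) by simp
  then show ?thesis
    using assms(4-6) by (simp add: add_divide_distrib)
qed


section \<open>The triangle of roots\<close>

text \<open>
  \<open>z1\<close>, \<open>z2\<close>, \<open>z3\<close> are the roots of \<open>cubic_P a b lam\<close> on the unit circle, described by the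
  relations between roots and coefficients, which are invariant under permutation of the roots.
\<close>
locale root_triangle =
  fixes a b lam z1 z2 z3 :: complex
  assumes neq: "z1 \<noteq> z2" "z2 \<noteq> z3" "z1 \<noteq> z3"
    and unit: "cmod z1 = 1" "cmod z2 = 1" "cmod z3 = 1"
    and root_sum: "z1 + z2 + z3 = a + b + lam * (cnj a * cnj b)"
    and root_sum2: "z1 * z2 + z2 * z3 + z1 * z3 = a * b + lam * (cnj a + cnj b)"
    and root_prod: "z1 * z2 * z3 = lam"
begin

lemma rotated: "root_triangle a b lam z2 z3 z1"
  using neq unit root_sum root_sum2 root_prod by unfold_locales (auto simp: algebra_simps)

lemma swapped: "root_triangle a b lam z2 z1 z3"
  using neq unit root_sum root_sum2 root_prod by unfold_locales (auto simp: algebra_simps)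

lemma root_mult_cnj: "z1 * cnj z1 = 1" "z2 * cnj z2 = 1" "z3 * cnj z3 = 1"
  using unit by (simp_all add: complex_norm_square[symmetric])

lemma lam_nonzero: "lam \<noteq> 0"
  using root_prod unit by auto

lemma root_equation: "z2 * z3 * ((1 - cnj a * z1) * (1 - cnj b * z1)) = (z1 - a) * (z1 - b)"
proof -
  have "z1 * (z2 * z3 * ((1 - cnj a * z1) * (1 - cnj b * z1))) = z1 * ((z1 - a) * (z1 - b))"
    using root_sum root_sum2 root_prod by algebra
  then show ?thesis using unit by auto
qed

text \<open>
  The value at \<open>z1\<close> of the partial fraction coefficient \<open>(z - a)(z - b) / ((z - z2)(z - z3))\<close>.
\<close>
definition weight :: complex where
  "weight = (z1 - a) * (z1 - b) / ((z1 - z2) * (z1 - z3))"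

lemma weight_eq: "weight * ((z1 - z2) * (z1 - z3)) = (z1 - a) * (z1 - b)"
  unfolding weight_def using neq by simp

text \<open>
  Conjugation replaces each root by its inverse, which turns numerator and denominator into the
  two sides of the equation satisfied by \<open>z1\<close>.
\<close>
lemma weight_real: "weight \<in> \<real>"
proof -
  have "cnj weight * ((cnj z1 - cnj z2) * (cnj z1 - cnj z3)) = (cnj z1 - cnj a) * (cnj z1 - cnj b)"
    using arg_cong[OF weight_eq, of cnj] by simp
  then have "cnj weight * ((z1 - z2) * (z1 - z3)) = z2 * z3 * ((1 - cnj a * z1) * (1 - cnj b * z1))"
    using root_mult_cnj by algebra
  then have "cnj weight * ((z1 - z2) * (z1 - z3)) = weight * ((z1 - z2) * (z1 - z3))"
    using root_equation weight_eq by simp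
  then show ?thesis using neq by (simp add: Reals_cnj_iff)
qed

definition mirror_focus :: complex where
  "mirror_focus = z1 + z2 - z1 * z2 * cnj a"

text \<open>The points of the chord satisfy \<open>z + z1 * z2 * cnj z = z1 + z2\<close>.\<close>
lemma mirror_focus_equidistant:
  fixes t :: real
  defines "z \<equiv> z1 + of_real t * (z2 - z1)"
  shows "cmod (z - mirror_focus) = cmod (z - a)"
proof -
  have "cnj z = cnj z1 + of_real t * (cnj z2 - cnj z1)" unfolding z_def by simp
  then have "z - mirror_focus = - (z1 * z2 * cnj (z - a))"
    unfolding z_def mirror_focus_def complex_cnj_diff using root_mult_cnj by algebra
  then have "cmod (z - mirror_focus) = cmod (z1 * z2 * cnj (z - a))"
    by (simp only: norm_minus_cancel)
  then show ?thesis using unit by (simp add: norm_mult del: complex_cnj_diff)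
qed

lemma cnj_mirror_focus_diff:
  "z1 * z2 * cnj (mirror_focus - b) = z1 + z2 - a - z1 * z2 * cnj b"
  unfolding mirror_focus_def using root_mult_cnj by simp algebra

lemma mirror_focus_dist: "cmod (mirror_focus - b) = cmod (1 - cnj a * b)"
proof -
  define w where "w = mirror_focus - b"
  define A where "A = cnj a"
  define B where "B = cnj b"
  define X where "X = 1 - A * z3"
  define Y where "Y = 1 - B * z3"
  \<comment> \<open>Both factors are expressed through \<open>z3\<close>, so that its equation \<open>z1 z2 X Y = (z3 - a)(z3 - b)\<close>
      applies.\<close>
  interpret r: root_triangle a b lam z2 z3 z1 by (rule rotated)
  interpret r': root_triangle a b lam z3 z1 z2 by (rule r.rotated)
  have w: "w = a - z3 - z1 * z2 * A * Y"
    unfolding w_def mirror_focus_def A_def B_def Y_def using root_sum root_prod by algebra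
  have w': "z1 * z2 * cnj w = b - z3 - z1 * z2 * B * X"
    unfolding w_def cnj_mirror_focus_diff A_def B_def X_def using root_sum root_prod by algebra
  have XY: "z1 * z2 * (X * Y) = (z3 - a) * (z3 - b)"
    unfolding X_def Y_def A_def B_def by (rule r'.root_equation)
  have "z1 * z2 * (w * cnj w) = w * (z1 * z2 * cnj w)" by simp
  also have "\<dots> = z1 * z2 * ((X - A * (b - z3)) * (Y - B * (a - z3)))"
    unfolding w' unfolding w using XY by algebra
  also have "\<dots> = z1 * z2 * ((1 - A * b) * (1 - B * a))"
    unfolding X_def Y_def by algebra
  finally have "w * cnj w = (1 - cnj a * b) * cnj (1 - cnj a * b)"
    using unit unfolding A_def B_def by (auto simp: mult.commute)
  then have "(cmod w)\<^sup>2 = (cmod (1 - cnj a * b))\<^sup>2"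
    unfolding complex_norm_square[symmetric] of_real_eq_iff .
  then show ?thesis unfolding w_def by simp
qed

text \<open>Twice the signed area of the triangle \<open>z, mirror_focus, b\<close>.\<close>
definition signed_double_area :: "complex \<Rightarrow> real" where
  "signed_double_area z = Im ((z - mirror_focus) * cnj (mirror_focus - b))"

lemma signed_double_area_affine:
  "signed_double_area (z + of_real t * (z2 - z1)) = signed_double_area z + t * (signed_double_area z2 - signed_double_area z1)"
  unfolding signed_double_area_def by (simp add: algebra_simps)

lemma conic_eqn_on_chord:
  fixes t :: real
  defines "z \<equiv> z1 + of_real t * (z2 - z1)"
  shows "conic_eqn a b (cmod (1 - cnj a * b)) z = - 4 * (signed_double_area z)\<^sup>2"
  unfolding signed_double_area_def
  by (rule conic_eqn_eq_area[OF _ mirror_focus_dist])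
     (unfold z_def, rule mirror_focus_equidistant)

text \<open>
  The signed area at an end of the chord is proportional to the weight there.  The constant of
  proportionality contains the discriminant factor \<open>(z1 - z2)(z1 - z3)(z3 - z2) / lam\<close>,
  which changes its sign when \<open>z1\<close> and \<open>z2\<close> are exchanged; the area form itself is symmetric in them.
\<close>
lemma signed_double_area_first:
  "of_real (2 * signed_double_area z1) * \<i> * lam = weight * ((z1 - z2) * (z1 - z3) * (z3 - z2))"
proof -
  define W where "W = cnj (mirror_focus - b)"
  have W: "z1 * z2 * W = z1 + z2 - a - z1 * z2 * cnj b"
    unfolding W_def by (rule cnj_mirror_focus_diff)
  have cW: "cnj W = z1 + z2 - z1 * z2 * cnj a - b"
    unfolding W_def mirror_focus_def by simp
  have 1: "z1 - mirror_focus = - z2 * (1 - z1 * cnj a)"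
    unfolding mirror_focus_def by algebra
  have 2: "z1 * z2 * cnj (z1 - mirror_focus) = - (z1 - a)"
    unfolding mirror_focus_def using root_mult_cnj by simp algebra
  have "of_real (2 * signed_double_area z1) * \<i> = (z1 - mirror_focus) * W - cnj (z1 - mirror_focus) * cnj W"
    unfolding signed_double_area_def W_def using complex_diff_cnj[of "(z1 - mirror_focus) * cnj (mirror_focus - b)"]
    by simp
  then have "of_real (2 * signed_double_area z1) * \<i> * lam
    = z3 * ((z1 - mirror_focus) * (z1 * z2 * W) - z1 * z2 * cnj (z1 - mirror_focus) * cnj W)"
    using root_prod by algebra
  also have "\<dots> = z3 * ((z1 - a) * (z1 - b)) - z2 * (z2 * z3 * ((1 - cnj a * z1) * (1 - cnj b * z1)))"
    unfolding 2 unfolding 1 W cW by algebra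
  also have "\<dots> = (z3 - z2) * ((z1 - a) * (z1 - b))"
    unfolding root_equation by algebra
  also have "\<dots> = weight * ((z1 - z2) * (z1 - z3) * (z3 - z2))"
    unfolding weight_eq[symmetric] by algebra
  finally show ?thesis .
qed

lemma signed_double_area_second:
  "of_real (2 * signed_double_area z2) * \<i> * lam
     = - (root_triangle.weight a b z2 z1 z3 * ((z1 - z2) * (z1 - z3) * (z3 - z2)))"
proof -
  interpret s: root_triangle a b lam z2 z1 z3 by (rule swapped)
  have "s.signed_double_area z2 = signed_double_area z2"
    unfolding s.signed_double_area_def signed_double_area_def s.mirror_focus_def mirror_focus_def
    by (simp add: algebra_simps)
  from s.signed_double_area_first[unfolded this] show ?thesis by algebra
qed

lemma radius_pos:
  assumes "cmod a \<noteq> 1"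
  shows "cmod (1 - cnj a * b) > 0"
proof (rule ccontr)
  assume "\<not> cmod (1 - cnj a * b) > 0"
  then have "cnj a * b = 1" by simp
  from arg_cong[OF this, of cnj] have *: "cnj b * a = 1" by (simp add: mult.commute)
  \<comment> \<open>Then \<open>a\<close> is a root, and all roots have modulus 1.\<close>
  have "(a - z1) * (a - z2) * (a - z3) = 0"
    using root_sum root_sum2 root_prod * by algebra
  then show False using unit assms by auto
qed

lemma weight_nonzero:
  assumes "cmod a \<noteq> 1" "cmod b \<noteq> 1"
  shows "weight \<noteq> 0"
  unfolding weight_def using assms unit neq by auto

text \<open>
  Up to the factor \<open>-4\<close> the equation on the chord is the square of twice the signed area, which is affine
  there.  It is \<open>\<kappa> * p\<close> at \<open>z1\<close> and \<open>- \<kappa> * q\<close> at \<open>z2\<close> with \<open>\<kappa> \<noteq> 0\<close>, hence it vanishes at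
  \<open>(p * z2 + q * z1) / (p + q)\<close>, or is constant on the chord if \<open>p + q = 0\<close>.
\<close>
lemma chord_contact:
  fixes p q :: real
  defines "r \<equiv> cmod (1 - cnj a * b)"
  assumes p: "of_real p = weight" and q: "of_real q = root_triangle.weight a b z2 z1 z3"
  shows "p + q \<noteq> 0 \<Longrightarrow> \<zeta> = (of_real p * z2 + of_real q * z1) / (of_real p + of_real q) \<Longrightarrow>
           double_contact_at (conic_eqn a b r) z1 z2 \<zeta> \<and>
           (cmod a \<noteq> 1 \<and> cmod b \<noteq> 1 \<longrightarrow>
              tangent_line_at (affine hull {z1, z2}) (focal_conic a b r) \<zeta>)"
    and "p + q = 0 \<Longrightarrow>
           double_contact_at_infinity (conic_eqn a b r) z1 z2 \<and>
           (cmod a \<noteq> 1 \<and> cmod b \<noteq> 1 \<longrightarrow>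
              asymptote_of (affine hull {z1, z2}) (focal_conic a b r))"
proof -
  define D where "D = (z1 - z2) * (z1 - z3) * (z3 - z2)"
  have D0: "D \<noteq> 0" unfolding D_def using neq by simp
  define g1 where "g1 = signed_double_area z1"
  define g2 where "g2 = signed_double_area z2"
  have g1: "of_real (2 * g1) * \<i> * lam = of_real p * D"
    using signed_double_area_first unfolding g1_def D_def p .
  have g2: "of_real (2 * g2) * \<i> * lam = - (of_real q * D)"
    using signed_double_area_second unfolding g2_def D_def q .
  have ndeg: "r > 0 \<and> r \<noteq> cmod (a - b)" if "cmod a \<noteq> 1 \<and> cmod b \<noteq> 1"
  proof -
    have sq: "x\<^sup>2 \<noteq> 1" if "x \<noteq> 1" "x \<ge> 0" for x :: real
      using that by (simp add: power2_eq_1_iff)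
    have "r\<^sup>2 - (cmod (a - b))\<^sup>2 \<noteq> 0"
      unfolding r_def cmod_one_minus_cnj_mult_power2 using sq[of "cmod a"] sq[of "cmod b"] that by auto
    then show ?thesis using radius_pos that unfolding r_def by auto
  qed
  have onL: "conic_eqn a b r (z1 + of_real t * (z2 - z1)) = - 4 * (g1 + t * (g2 - g1))\<^sup>2" for t
    unfolding r_def conic_eqn_on_chord signed_double_area_affine g1_def g2_def ..

  {
    assume pq: "p + q \<noteq> 0" and \<zeta>: "\<zeta> = (of_real p * z2 + of_real q * z1) / (of_real p + of_real q)"
    define x where "x = p / (p + q)"
    have pq': "complex_of_real p + of_real q \<noteq> 0"
      using pq unfolding of_real_add[symmetric] of_real_eq_0_iff .
    have \<zeta>x: "\<zeta> = z1 + of_real x * (z2 - z1)"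
      unfolding \<zeta> x_def using pq' by (simp add: field_simps)
    have "of_real (p * g2 + q * g1) * (2 * \<i> * lam) = 0"
      using g1 g2 unfolding of_real_add of_real_mult of_real_numeral by algebra
    then have "complex_of_real (p * g2 + q * g1) = 0"
      using lam_nonzero by simp
    then have bal: "p * g2 + q * g1 = 0" unfolding of_real_eq_0_iff .
    have zero: "g1 + x * (g2 - g1) = 0"
      unfolding x_def using pq bal by (simp add: field_simps)
    have dc: "double_contact_at (conic_eqn a b r) z1 z2 \<zeta>"
      unfolding double_contact_at_def
    proof (intro conjI exI allI)
      show "\<zeta> \<in> affine hull {z1, z2}" unfolding \<zeta>x by (rule on_line_through)
      fix t :: real
      have "\<zeta> + of_real t * (z2 - z1) = z1 + of_real (x + t) * (z2 - z1)"
        unfolding \<zeta>x by (simp add: algebra_simps)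
      then have "conic_eqn a b r (\<zeta> + of_real t * (z2 - z1)) = - 4 * (g1 + (x + t) * (g2 - g1))\<^sup>2"
        by (simp only: onL)
      also have "\<dots> = (- 4 * (g2 - g1)\<^sup>2) * t\<^sup>2"
        using zero by algebra
      finally show "conic_eqn a b r (\<zeta> + of_real t * (z2 - z1)) = (- 4 * (g2 - g1)\<^sup>2) * t\<^sup>2" .
    qed
    then show "double_contact_at (conic_eqn a b r) z1 z2 \<zeta> \<and>
           (cmod a \<noteq> 1 \<and> cmod b \<noteq> 1 \<longrightarrow>
              tangent_line_at (affine hull {z1, z2}) (focal_conic a b r) \<zeta>)"
      using double_contact_imp_tangent[OF _ _ neq(1) dc] ndeg by blast
  }
  {
    assume pq: "p + q = 0"
    then have qp: "q = - p" by simp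
    have "of_real (g2 - g1) * (2 * \<i> * lam) = 0"
      using g1 g2 unfolding qp of_real_diff of_real_mult of_real_numeral of_real_minus by algebra
    then have "complex_of_real (g2 - g1) = 0" using lam_nonzero by simp
    then have eq: "g2 = g1" by simp
    have dc: "double_contact_at_infinity (conic_eqn a b r) z1 z2"
      unfolding double_contact_at_infinity_def onL eq by auto
    have "asymptote_of (affine hull {z1, z2}) (focal_conic a b r)" if ab: "cmod a \<noteq> 1 \<and> cmod b \<noteq> 1"
    proof (rule double_contact_at_infinity_imp_asymptote[OF _ _ neq(1) dc])
      have "g1 \<noteq> 0"
      proof
        assume "g1 = 0"
        then have "weight * D = 0" using g1 p by simp
        then show False using D0 weight_nonzero ab by simp
      qed
      then show "conic_eqn a b r z1 \<noteq> 0" using onL[of 0] by simp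
    qed (use ndeg ab in auto)
    then show "double_contact_at_infinity (conic_eqn a b r) z1 z2 \<and>
           (cmod a \<noteq> 1 \<and> cmod b \<noteq> 1 \<longrightarrow>
              asymptote_of (affine hull {z1, z2}) (focal_conic a b r))"
      using dc by simp
  }
qed

end

lemma root_triangle_cubic_P:
  assumes "distinct [z1, z2, z3]"
    and "{z. cubic_P a b lam z = 0} = {z1, z2, z3}"
    and "cmod z1 = 1" "cmod z2 = 1" "cmod z3 = 1"
  shows "root_triangle a b lam z1 z2 z3"
proof -
  have ne: "z1 \<noteq> z2" "z2 \<noteq> z3" "z1 \<noteq> z3" using assms(1) by auto
  have "t ^ 3 - (a + b + lam * (cnj a * cnj b)) * t ^ 2
      + (a * b + lam * (cnj a + cnj b)) * t - lam = 0" if "t \<in> {z1, z2, z3}" for t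
  proof -
    have "cubic_P a b lam t = 0" using that assms(2) by blast
    then show ?thesis unfolding cubic_P_def by algebra
  qed
  note v = monic_cubic_vieta[OF ne this]
  show ?thesis by unfold_locales (use ne assms v in auto)
qed

text \<open>
  The three chords are handled by the six orderings of the roots: each chord needs the weights at
  both of its ends, and the weight at \<open>z1\<close> does not depend on the order of the other two roots.
\<close>
theorem theorem2p1:
  fixes a b lam z1 z2 z3 :: complex
  assumes "cmod lam = 1"
    and "distinct [z1, z2, z3]"
    and "{z. cubic_P a b lam z = 0} = {z1, z2, z3}"
    and "cmod z1 = 1" and "cmod z2 = 1" and "cmod z3 = 1"
  defines "r \<equiv> cmod (1 - cnj a * b)"
  shows "(\<exists>m1 m2 m3 :: real.
      (\<forall>z. z \<notin> {z1, z2, z3} \<longrightarrow>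
         (z - a) * (z - b) / ((z - z1) * (z - z2) * (z - z3)) =
         of_real m1 / (z - z1) + of_real m2 / (z - z2) + of_real m3 / (z - z3)) \<and>
      (\<forall>(u, v, p, q) \<in> {(z1, z2, m1, m2), (z2, z3, m2, m3), (z1, z3, m1, m3)}.
         (p + q \<noteq> 0 \<longrightarrow>
            (let \<zeta> = (of_real p * v + of_real q * u) / (of_real p + of_real q) in
               double_contact_at (conic_eqn a b r) u v \<zeta> \<and>
               (cmod a \<noteq> 1 \<and> cmod b \<noteq> 1 \<longrightarrow>
                  tangent_line_at (affine hull {u, v}) (focal_conic a b r) \<zeta>))) \<and>
         (p + q = 0 \<longrightarrow>
            double_contact_at_infinity (conic_eqn a b r) u v \<and>
            (cmod a \<noteq> 1 \<and> cmod b \<noteq> 1 \<longrightarrow>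
               asymptote_of (affine hull {u, v}) (focal_conic a b r)))))
    \<and> ((cmod a < 1 \<and> cmod b < 1) \<or> (cmod a > 1 \<and> cmod b > 1) \<longrightarrow>
         focal_conic a b r = conic_plus a b r \<and> is_ellipse (conic_plus a b r))
    \<and> ((cmod a < 1 \<and> cmod b > 1) \<or> (cmod a > 1 \<and> cmod b < 1) \<longrightarrow>
         focal_conic a b r = conic_minus a b r \<and> is_hyperbola (conic_minus a b r))"
proof (intro conjI[OF _ conjI])
  interpret t123: root_triangle a b lam z1 z2 z3
    by (rule root_triangle_cubic_P) (use assms in auto)
  interpret t231: root_triangle a b lam z2 z3 z1 by (rule t123.rotated)
  interpret t312: root_triangle a b lam z3 z1 z2 by (rule t231.rotated)
  interpret t213: root_triangle a b lam z2 z1 z3 by (rule t123.swapped)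
  interpret t321: root_triangle a b lam z3 z2 z1 by (rule t231.swapped)
  interpret t132: root_triangle a b lam z1 z3 z2 by (rule t312.swapped)
  define m1 where "m1 = Re t123.weight"
  define m2 where "m2 = Re t231.weight"
  define m3 where "m3 = Re t312.weight"
  have m: "of_real m1 = t123.weight" "of_real m2 = t231.weight" "of_real m3 = t312.weight"
    unfolding m1_def m2_def m3_def
    using t123.weight_real t231.weight_real t312.weight_real by simp_all
  have m': "of_real m1 = t132.weight" "of_real m2 = t213.weight" "of_real m3 = t321.weight"
    unfolding m t123.weight_def t231.weight_def t312.weight_def
      t132.weight_def t213.weight_def t321.weight_def by (simp_all add: mult.commute)
  show "\<exists>m1 m2 m3 :: real.
      (\<forall>z. z \<notin> {z1, z2, z3} \<longrightarrow>
         (z - a) * (z - b) / ((z - z1) * (z - z2) * (z - z3)) =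
         of_real m1 / (z - z1) + of_real m2 / (z - z2) + of_real m3 / (z - z3)) \<and>
      (\<forall>(u, v, p, q) \<in> {(z1, z2, m1, m2), (z2, z3, m2, m3), (z1, z3, m1, m3)}.
         (p + q \<noteq> 0 \<longrightarrow>
            (let \<zeta> = (of_real p * v + of_real q * u) / (of_real p + of_real q) in
               double_contact_at (conic_eqn a b r) u v \<zeta> \<and>
               (cmod a \<noteq> 1 \<and> cmod b \<noteq> 1 \<longrightarrow>
                  tangent_line_at (affine hull {u, v}) (focal_conic a b r) \<zeta>))) \<and>
         (p + q = 0 \<longrightarrow>
            double_contact_at_infinity (conic_eqn a b r) u v \<and>
            (cmod a \<noteq> 1 \<and> cmod b \<noteq> 1 \<longrightarrow>
               asymptote_of (affine hull {u, v}) (focal_conic a b r))))"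
  proof (intro exI conjI allI impI)
    fix z assume "z \<notin> {z1, z2, z3}"
    then show "(z - a) * (z - b) / ((z - z1) * (z - z2) * (z - z3)) =
         of_real m1 / (z - z1) + of_real m2 / (z - z2) + of_real m3 / (z - z3)"
      using t123.neq t123.weight_eq t213.weight_eq t312.weight_eq
      by (intro partial_fractions_three_poles) (simp_all add: m(1,3) m'(2))
  next
    show "\<forall>(u, v, p, q) \<in> {(z1, z2, m1, m2), (z2, z3, m2, m3), (z1, z3, m1, m3)}.
         (p + q \<noteq> 0 \<longrightarrow>
            (let \<zeta> = (of_real p * v + of_real q * u) / (of_real p + of_real q) in
               double_contact_at (conic_eqn a b r) u v \<zeta> \<and>
               (cmod a \<noteq> 1 \<and> cmod b \<noteq> 1 \<longrightarrow>
                  tangent_line_at (affine hull {u, v}) (focal_conic a b r) \<zeta>))) \<and>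
         (p + q = 0 \<longrightarrow>
            double_contact_at_infinity (conic_eqn a b r) u v \<and>
            (cmod a \<noteq> 1 \<and> cmod b \<noteq> 1 \<longrightarrow>
               asymptote_of (affine hull {u, v}) (focal_conic a b r)))"
      unfolding Let_def r_def
      using t123.chord_contact[OF m(1) m'(2)] t231.chord_contact[OF m(2) m'(3)]
        t132.chord_contact[OF m'(1) m(3)]
      by simp
  qed
  have less_iff: "cmod z < 1 \<longleftrightarrow> 1 - (cmod z)\<^sup>2 > 0" "cmod z > 1 \<longleftrightarrow> 1 - (cmod z)\<^sup>2 < 0" for z
    using abs_square_less_1[of "cmod z"] abs_square_le_1[of "cmod z"] by auto
  have rsq: "r\<^sup>2 - (cmod (a - b))\<^sup>2 = (1 - (cmod a)\<^sup>2) * (1 - (cmod b)\<^sup>2)"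
    unfolding r_def by (rule cmod_one_minus_cnj_mult_power2)
  have r0: "r \<ge> 0" unfolding r_def by simp
  show "(cmod a < 1 \<and> cmod b < 1) \<or> (cmod a > 1 \<and> cmod b > 1) \<longrightarrow>
         focal_conic a b r = conic_plus a b r \<and> is_ellipse (conic_plus a b r)"
  proof
    assume "(cmod a < 1 \<and> cmod b < 1) \<or> (cmod a > 1 \<and> cmod b > 1)"
    then have "r\<^sup>2 - (cmod (a - b))\<^sup>2 > 0"
      unfolding rsq less_iff by (auto intro: mult_pos_pos mult_neg_neg)
    then have "cmod (a - b) < r" using r0 by (simp add: power2_less_imp_less)
    then show "focal_conic a b r = conic_plus a b r \<and> is_ellipse (conic_plus a b r)"
      using focal_conic_ellipse by blast
  qed
  show "(cmod a < 1 \<and> cmod b > 1) \<or> (cmod a > 1 \<and> cmod b < 1) \<longrightarrow>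
         focal_conic a b r = conic_minus a b r \<and> is_hyperbola (conic_minus a b r)"
  proof
    assume ab: "(cmod a < 1 \<and> cmod b > 1) \<or> (cmod a > 1 \<and> cmod b < 1)"
    then have "r\<^sup>2 - (cmod (a - b))\<^sup>2 < 0"
      unfolding rsq less_iff by (auto intro: mult_pos_neg mult_neg_pos)
    then have "r < cmod (a - b)" by (simp add: power2_less_imp_less)
    moreover have "r > 0" using t123.radius_pos ab unfolding r_def by auto
    ultimately show "focal_conic a b r = conic_minus a b r \<and> is_hyperbola (conic_minus a b r)"
      using focal_conic_hyperbola by blast
  qed
qed

end
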